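(* Let $C$ be a nonempty, closed, bounded, convex, weakly compact subset of a real Banach space $X$, and let $f:X\to\mathbb{R}$ be a convex, continuously Fréchet differentiable function whose Fréchet derivative $f':X\to X^*$ is uniformly continuous on $C$. Assume that $f$ attains its minimum over $C$. Let $\{x_k\}_{k\ge0}$ be a sequence generated by the Frank-Wolfe algorithm from an arbitrary $x_0\in C$, with stepsizes $\{\gamma_k\}\subset(0,1]$ satisfying $\lim_{k\to\infty}\gamma_k=0$ and $\sum_{k=0}^\infty\gamma_k=\infty$. Then $\lim_{k\to\infty}f(x_k)=\inf_{x\in C}f(x)$.
   Context: $X^*$ is the dual of $X$ and $\langle x^*,x\rangle=x^*(x)$ is the duality pairing. Frank-Wolfe algorithm for $\min_{x\in C}f(x)$: given $x_0\in C$, for each $k\ge 0$ choose $\bar x_k\in C$ to be a minimizer of $x\mapsto\langle f'(x_k),x\rangle$ over $C$, and set $x_{k+1}=x_k+\gamma_k(\bar x_k-x_k)$, where $\gamma_k$ is the stepsize. *)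

theory Defs
  imports "HOL-Analysis.Analysis"
begin

text \<open>The coarsest topology making every continuous linear functional continuous.\<close>

definition weak_topology :: "'a::real_normed_vector topology" where
  "weak_topology =
     topology_generated_by {blinfun_apply \<phi> -` U | (\<phi> :: 'a \<Rightarrow>\<^sub>L real) U. open U}"

definition weakly_compact :: "'a::real_normed_vector set \<Rightarrow> bool" where
  "weakly_compact C \<longleftrightarrow> compactin weak_topology C"

text \<open>
  The minimizers \<open>xbar k\<close> need not be unique; the definition admits any sequence
  of iterates arising from some choice of them.
\<close>

definition frank_wolfe_sequence ::
  "'a::real_normed_vector set \<Rightarrow> ('a \<Rightarrow> 'a \<Rightarrow>\<^sub>L real) \<Rightarrow> (nat \<Rightarrow> real) \<Rightarrow> (nat \<Rightarrow> 'a) \<Rightarrow> bool"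
where
  "frank_wolfe_sequence C f' \<gamma> x \<longleftrightarrow>
     x 0 \<in> C \<and>
     (\<exists>xbar. \<forall>k. is_arg_min (blinfun_apply (f' (x k))) (\<lambda>y. y \<in> C) (xbar k) \<and>
                 x (Suc k) = x k + \<gamma> k *\<^sub>R (xbar k - x k))"

end

theory Submission
  imports Defs
begin

text \<open>
  Let \<open>h k = f (x k) - f z\<close>, where \<open>z\<close> minimizes \<open>f\<close> over \<open>C\<close>. The gradient inequality at \<open>x (Suc k)\<close> bounds the change of \<open>f\<close> along
  a step from above by \<open>\<gamma> k * f' (x (Suc k)) (xbar k - x k)\<close>; replacing \<open>f' (x (Suc k))\<close> by \<open>f' (x k)\<close> costs an
  error \<open>e k\<close> which tends to 0 by uniform continuity, and the minimality of \<open>xbar k\<close> together with the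
  gradient inequality at \<open>x k\<close> bounds the rest by \<open>- \<gamma> k * h k\<close>. Hence
  \<open>h (Suc k) \<le> (1 - \<gamma> k) * h k + \<gamma> k * e k\<close>, and divergence of the sum of the stepsizes forces
  \<open>h\<close> to tend to 0.
\<close>

text \<open>Restricting \<open>f\<close> to the line through \<open>y\<close> and \<open>z\<close>
  reduces the claim to one real variable: the convex function \<open>g\<close> lies above its
  tangent at 0, and this is read off at 1.\<close>

lemma convex_on_gradient_inequality:
  fixes f :: "'a::real_normed_vector \<Rightarrow> real"
  assumes "convex_on UNIV f" and deriv: "(f has_derivative f') (at y)"
  shows "f z \<ge> f y + f' (z - y)"
proof -
  define g where "g t = f (y + t *\<^sub>R (z - y))" for t :: real
  have "convex_on UNIV g"
  proof (rule convex_onI)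
    fix t a b :: real
    assume t: "0 < t" "t < 1"
    have "y + ((1 - t) *\<^sub>R a + t *\<^sub>R b) *\<^sub>R (z - y)
        = (1 - t) *\<^sub>R (y + a *\<^sub>R (z - y)) + t *\<^sub>R (y + b *\<^sub>R (z - y))"
      by (simp add: algebra_simps)
    then show "g ((1 - t) *\<^sub>R a + t *\<^sub>R b) \<le> (1 - t) * g a + t * g b"
      unfolding g_def using convex_onD[OF assms(1), of t] t by (metis UNIV_I less_imp_le)
  qed simp
  \<comment> \<open>The chain rule gives the derivative
    \<open>\<lambda>t. f' (t *\<^sub>R (z - y))\<close>, which by linearity is multiplication by the
    number \<open>f' (z - y)\<close>.\<close>
  moreover have "(g has_field_derivative f' (z - y)) (at 0)"
  proof -
    interpret bounded_linear f' using deriv by (rule has_derivative_bounded_linear)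
    have "((\<lambda>t. y + t *\<^sub>R (z - y)) has_derivative (\<lambda>t. t *\<^sub>R (z - y))) (at 0)"
      by (auto intro!: derivative_eq_intros)
    from has_derivative_compose[OF this, of f f'] deriv
    have "(g has_derivative (\<lambda>t. f' (t *\<^sub>R (z - y)))) (at 0)"
      by (simp add: g_def[abs_def])
    then show ?thesis
      by (simp add: has_field_derivative_def scaleR mult_commute_abs)
  qed
  ultimately have "g 1 - g 0 \<ge> f' (z - y) * (1 - 0)"
    by (intro convex_on_imp_above_tangent[where A = UNIV]) auto
  then show ?thesis by (simp add: g_def)
qed

text \<open>Once \<open>e k < \<epsilon>\<close>, a step multiplies the excess over
  \<open>\<epsilon>\<close> by at most \<open>1 - \<gamma> k \<le> exp (- \<gamma> k)\<close>. These
  factors accumulate to the exponential of minus the sum of the stepsizes, which tends to 0 because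
  the sum diverges.\<close>

lemma averaging_recursion_tendsto_zero:
  fixes h \<gamma> e :: "nat \<Rightarrow> real"
  assumes nonneg: "\<And>k. 0 \<le> h k"
    and rec: "\<And>k. h (Suc k) \<le> (1 - \<gamma> k) * h k + \<gamma> k * e k"
    and \<gamma>: "\<And>k. 0 \<le> \<gamma> k" "\<And>k. \<gamma> k \<le> 1"
    and diverges: "filterlim (\<lambda>n. \<Sum>k<n. \<gamma> k) at_top sequentially"
    and e: "e \<longlonglongrightarrow> 0"
  shows "h \<longlonglongrightarrow> 0"
proof (rule LIMSEQ_I)
  fix r :: real
  assume "0 < r"
  \<comment> \<open>One half of \<open>r\<close> absorbs the errors \<open>e k\<close>, the other
    the exponentially decaying term.\<close>
  define \<epsilon> where "\<epsilon> = r / 2"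
  have "\<epsilon> > 0" using \<open>0 < r\<close> by (simp add: \<epsilon>_def)
  define S where "S n = (\<Sum>k<n. \<gamma> k)" for n
  obtain N where N: "\<And>k. k \<ge> N \<Longrightarrow> e k < \<epsilon>"
    using order_tendstoD(2)[OF e \<open>\<epsilon> > 0\<close>] by (auto simp: eventually_sequentially)
  \<comment> \<open>Normalized so that at \<open>n = N\<close> the bound below reads
    \<open>h N \<le> \<epsilon> + h N\<close>.\<close>
  define K where "K = h N * exp (S N)"
  have bound: "h n \<le> \<epsilon> + K * exp (- S n)" if "n \<ge> N" for n
    using that
  proof (induction rule: dec_induct)
    case base
    then show ?case using \<open>\<epsilon> > 0\<close> by (simp add: K_def mult.assoc flip: exp_add)
  next
    case (step n)
    have "K \<ge> 0" by (simp add: K_def nonneg)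
    \<comment> \<open>Since \<open>1 - \<gamma> n\<close> is nonnegative, the induction hypothesis
      can be inserted into the recursion; the weights of the two \<open>\<epsilon>\<close> terms add
      up to 1.\<close>
    have "h (Suc n) \<le> (1 - \<gamma> n) * (\<epsilon> + K * exp (- S n)) + \<gamma> n * \<epsilon>"
      using rec[of n] mult_left_mono[OF step.IH, of "1 - \<gamma> n"] \<gamma>[of n]
        mult_left_mono[of "e n" \<epsilon> "\<gamma> n"] N[of n] step.hyps by linarith
    also have "\<dots> = \<epsilon> + (1 - \<gamma> n) * (K * exp (- S n))"
      by (simp add: algebra_simps)
    also have "\<dots> \<le> \<epsilon> + exp (- \<gamma> n) * (K * exp (- S n))"
      using exp_ge_add_one_self[of "- \<gamma> n"] \<open>K \<ge> 0\<close>
      by (intro add_left_mono mult_right_mono) auto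
    also have "\<dots> = \<epsilon> + K * exp (- S (Suc n))"
      by (simp add: S_def exp_add exp_diff exp_minus field_simps)
    finally show ?case .
  qed
  have "(\<lambda>n. exp (- S n)) \<longlonglongrightarrow> 0"
    using diverges unfolding S_def
    by (intro filterlim_compose[OF exp_at_bot] filterlim_compose[OF filterlim_uminus_at_bot_at_top])
  then have "(\<lambda>n. K * exp (- S n)) \<longlonglongrightarrow> 0" by (rule tendsto_mult_right_zero)
  from order_tendstoD(2)[OF this \<open>\<epsilon> > 0\<close>]
  obtain M where M: "\<And>n. n \<ge> M \<Longrightarrow> K * exp (- S n) < \<epsilon>"
    by (auto simp: eventually_sequentially)
  have "norm (h n - 0) < r" if "n \<ge> max M N" for n
    using bound[of n] M[of n] nonneg[of n] that by (simp add: \<epsilon>_def)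
  then show "\<exists>no. \<forall>n\<ge>no. norm (h n - 0) < r" by blast
qed

theorem theorem3p3:
  fixes C :: "'a::banach set"
    and f :: "'a \<Rightarrow> real"
    and f' :: "'a \<Rightarrow> 'a \<Rightarrow>\<^sub>L real"
    and \<gamma> :: "nat \<Rightarrow> real"
    and x :: "nat \<Rightarrow> 'a"
  assumes "C \<noteq> {}" and "closed C" and "bounded C" and "convex C" and "weakly_compact C"
    and "convex_on UNIV f"
    and "\<And>y. (f has_derivative blinfun_apply (f' y)) (at y)"
    and "continuous_on UNIV f'"
    and "uniformly_continuous_on C f'"
    and "\<exists>z. is_arg_min f (\<lambda>y. y \<in> C) z"
    and "\<And>k. \<gamma> k \<in> {0<..1}"
    and "\<gamma> \<longlonglongrightarrow> 0"
    and "filterlim (\<lambda>n. \<Sum>k<n. \<gamma> k) at_top sequentially"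
    and "frank_wolfe_sequence C f' \<gamma> x"
  shows "(\<lambda>k. f (x k)) \<longlonglongrightarrow> (INF y\<in>C. f y)"
proof -
  obtain z where "is_arg_min f (\<lambda>y. y \<in> C) z" using assms(10) by blast
  then have z: "z \<in> C" "\<And>y. y \<in> C \<Longrightarrow> f z \<le> f y"
    by (auto simp: is_arg_min_linorder)
  have INF_eq: "(INF y\<in>C. f y) = f z"
    using z by (intro cInf_eq_minimum) auto
  obtain xbar where x0: "x 0 \<in> C"
    and argmin: "\<And>k. is_arg_min (f' (x k)) (\<lambda>y. y \<in> C) (xbar k)"
    and step: "\<And>k. x (Suc k) = x k + \<gamma> k *\<^sub>R (xbar k - x k)"
    using assms(14) unfolding frank_wolfe_sequence_def by blast
  have xbar: "xbar k \<in> C" "\<And>y. y \<in> C \<Longrightarrow> f' (x k) (xbar k) \<le> f' (x k) y" for k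
    using argmin[of k] by (auto simp: is_arg_min_linorder)
  have \<gamma>: "0 \<le> \<gamma> k" "\<gamma> k \<le> 1" for k
    using assms(11)[of k] by auto
  have x: "x k \<in> C" for k
  proof (induction k)
    case (Suc k)
    have "x (Suc k) = (1 - \<gamma> k) *\<^sub>R x k + \<gamma> k *\<^sub>R xbar k"
      by (simp add: step algebra_simps)
    then show ?case
      using convexD_alt[OF assms(4) Suc xbar(1)] \<gamma> by metis
  qed (rule x0)
  \<comment> \<open>Both \<open>x k\<close> and \<open>xbar k\<close> stay in the bounded set
    \<open>C\<close>, so a step has length at most \<open>\<gamma> k * D\<close>, which vanishes
    with \<open>\<gamma> k\<close>.\<close>
  define D where "D = diameter C"
  have D: "norm (xbar k - x k) \<le> D" for k
    using diameter_bounded_bound[OF assms(3) xbar(1) x, of k k] by (simp add: D_def dist_norm)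
  have "(\<lambda>k. norm (x (Suc k) - x k)) \<longlonglongrightarrow> 0"
  proof (rule tendsto_sandwich[OF _ _ tendsto_const])
    show "(\<lambda>k. \<gamma> k * D) \<longlonglongrightarrow> 0"
      using assms(12) by (rule tendsto_mult_left_zero)
    show "\<forall>\<^sub>F k in sequentially. norm (x (Suc k) - x k) \<le> \<gamma> k * D"
      using \<gamma> D by (intro always_eventually) (simp add: step mult_left_mono)
  qed simp
  then have "(\<lambda>k. dist (x (Suc k)) (x k)) \<longlonglongrightarrow> 0"
    by (simp add: dist_norm)
  \<comment> \<open>The sequential form of uniform continuity asks only that the distance between
    the two sequences vanish; neither has to converge.\<close>
  then have "(\<lambda>k. dist (f' (x (Suc k))) (f' (x k))) \<longlonglongrightarrow> 0"
    using x assms(9)[unfolded uniformly_continuous_on_sequentially, rule_format,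
      of "\<lambda>k. x (Suc k)" x] by simp
  then have e: "(\<lambda>k. norm (f' (x (Suc k)) - f' (x k)) * D) \<longlonglongrightarrow> 0"
    by (auto simp: dist_norm intro: tendsto_mult_left_zero)
  have "(\<lambda>k. f (x k) - f z) \<longlonglongrightarrow> 0"
  proof (rule averaging_recursion_tendsto_zero[OF _ _ \<gamma> assms(13) e])
    show "0 \<le> f (x k) - f z" for k using z x by simp
    show "f (x (Suc k)) - f z \<le> (1 - \<gamma> k) * (f (x k) - f z)
        + \<gamma> k * (norm (f' (x (Suc k)) - f' (x k)) * D)" for k
    proof -
      let ?d = "xbar k - x k"
      \<comment> \<open>Placing the tangent at the new iterate makes convexity an upper bound on
        \<open>f (x (Suc k))\<close>; the displacement back to \<open>x k\<close> is
        \<open>- \<gamma> k *\<^sub>R ?d\<close>.\<close>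
      have "f (x k) \<ge> f (x (Suc k)) + f' (x (Suc k)) (x k - x (Suc k))"
        by (rule convex_on_gradient_inequality[OF assms(6,7)])
      then have "f (x (Suc k)) \<le> f (x k) + \<gamma> k * f' (x (Suc k)) ?d"
        by (simp add: step blinfun.minus_right blinfun.scaleR_right)
      moreover have "f' (x (Suc k)) ?d \<le> f z - f (x k) + norm (f' (x (Suc k)) - f' (x k)) * D"
      proof -
        have "f' (x k) ?d \<le> f' (x k) (z - x k)"
          using xbar(2)[OF z(1), of k] by (simp add: blinfun.diff_right)
        also have "\<dots> \<le> f z - f (x k)"
          using convex_on_gradient_inequality[OF assms(6,7), of "x k" z] by simp
        finally have "f' (x k) ?d \<le> f z - f (x k)" .
        \<comment> \<open>The operator norm bounds the change of gradient along \<open>?d\<close>,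
          whose length is at most \<open>D\<close>.\<close>
        moreover have "(f' (x (Suc k)) - f' (x k)) ?d \<le> norm (f' (x (Suc k)) - f' (x k)) * D"
          using norm_blinfun[of "f' (x (Suc k)) - f' (x k)" ?d]
            mult_left_mono[OF D[of k], of "norm (f' (x (Suc k)) - f' (x k))"] by simp
        ultimately show ?thesis by (simp add: blinfun.diff_left)
      qed
      ultimately have "f (x (Suc k)) \<le> f (x k)
          + \<gamma> k * (f z - f (x k) + norm (f' (x (Suc k)) - f' (x k)) * D)"
        using \<gamma>(1)[of k] by (meson add_left_mono mult_left_mono order_trans)
      then show ?thesis by (simp add: algebra_simps)
    qed
  qed
  then show ?thesis by (simp add: INF_eq LIM_zero_iff)
qed

end
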